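(* Let $z_1,\ldots,z_m$ be distinct nonzero points in the open unit disk $\mathbb{D}$, let $l_1,\ldots,l_m$ be positive integers, and $r=l_1+\cdots+l_m\le N$. Let $\alpha_0,\ldots,\alpha_{N-r}\in\mathbb{D}$. If there exists an $N\times N$ truncated CMV matrix $\mathcal{T}$ such that $z_1,\ldots,z_m$ are eigenvalues of $\mathcal{T}$ with the algebraic multiplicities $l_1,\ldots,l_m$, and $\alpha_j(\mathcal{T})=\alpha_j$ for $j=0,\ldots,N-r$, then this matrix is unique.
   Context: An $N\times N$ truncated CMV matrix is determined by numbers $\alpha_0,\dots,\alpha_{N-1}\in\mathbb{D}$ and $|\alpha_N|=1$; with $\rho_n=\sqrt{1-|\alpha_n|^2}$, $\mathcal{T}=\mathcal{T}(\{\alpha_n\}_{n=0}^N)=(t_{ij})_{i,j=1}^N$ has entries $t_{m,m}=-\bar\alpha_m\alpha_{m-1}$; for $m$ odd: $t_{m+1,m}=\bar\alpha_{m+1}\rho_m$, $t_{m,m+1}=-\alpha_{m-1}\rho_m$, $t_{m+2,m}=\rho_m\rho_{m+1}$, $t_{m,m+2}=0$; for $m$ even: $t_{m+1,m}=-\alpha_{m-1}\rho_m$, $t_{m,m+1}=\bar\alpha_{m+1}\rho_m$, $t_{m+2,m}=0$, $t_{m,m+2}=\rho_m\rho_{m+1}$ (whenever the indices are $\le N$); all other entries are $0$. The numbers $\alpha_n=\alpha_n(\mathcal{T})$, $n=0,\dots,N$, are called the parameters of $\mathcal{T}$. *)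

theory Defs
  imports Complex_Main "Jordan_Normal_Form.Char_Poly"
begin

definition cmv_params :: "nat \<Rightarrow> (nat \<Rightarrow> complex) \<Rightarrow> bool" where
  "cmv_params N a \<longleftrightarrow> (\<forall>n<N. cmod (a n) < 1) \<and> cmod (a N) = 1"

definition cmv_rho :: "(nat \<Rightarrow> complex) \<Rightarrow> nat \<Rightarrow> real" where
  "cmv_rho a n = sqrt (1 - (cmod (a n))\<^sup>2)"

(* The entry t_{ij}, with rows and columns numbered from 1. *)
definition cmv_entry :: "(nat \<Rightarrow> complex) \<Rightarrow> nat \<Rightarrow> nat \<Rightarrow> complex" where
  "cmv_entry a i j =
     (if i = j then - cnj (a j) * a (j - 1)
      else if i = j + 1 then
        (if odd j then cnj (a (j + 1)) * of_real (cmv_rho a j)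
         else - a (j - 1) * of_real (cmv_rho a j))
      else if j = i + 1 then
        (if odd i then - a (i - 1) * of_real (cmv_rho a i)
         else cnj (a (i + 1)) * of_real (cmv_rho a i))
      else if i = j + 2 \<and> odd j then of_real (cmv_rho a j * cmv_rho a (j + 1))
      else if j = i + 2 \<and> even i then of_real (cmv_rho a i * cmv_rho a (i + 1))
      else 0)"

(* The library numbers rows and columns from 0. *)
definition trunc_cmv :: "nat \<Rightarrow> (nat \<Rightarrow> complex) \<Rightarrow> complex mat" where
  "trunc_cmv N a = mat N N (\<lambda>(i, j). cmv_entry a (i + 1) (j + 1))"

(* A relation rather than a function of the matrix: values of a beyond N are irrelevant,
   and for N = 1 the zero matrix does not determine a 1. *)
definition has_cmv_params :: "nat \<Rightarrow> complex mat \<Rightarrow> (nat \<Rightarrow> complex) \<Rightarrow> bool" where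
  "has_cmv_params N T a \<longleftrightarrow> cmv_params N a \<and> T = trunc_cmv N a"

definition eigenvalue_of_mult :: "complex mat \<Rightarrow> complex \<Rightarrow> nat \<Rightarrow> bool" where
  "eigenvalue_of_mult T z l \<longleftrightarrow> eigenvalue T z \<and> order z (char_poly T) = l"

end

theory Submission
  imports Defs
begin

text \<open>
  The characteristic polynomial of a truncated CMV matrix is what the Szego recursion produces
  from the parameters, started at the vector \<open>(1, - a 0)\<close>. It follows by writing the
  pentadiagonal matrix as a product of two block diagonal matrices, which turns the
  characteristic determinant into a tridiagonal one (lemma \<open>char_poly_trunc_cmv\<close>).

  Suppose that two parameter sequences agree up to index \<open>N - r\<close>. Running the recursion over the
  common parameters gives one pair of polynomials \<open>(f, g)\<close>, and both characteristic polynomials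
  have the form \<open>z Q f + S g\<close>, where \<open>Q\<close> and \<open>S\<close> of degree at most \<open>r - 1\<close> depend on the last
  \<open>r\<close> parameters only (\<open>szego_phi_split\<close>). The quotient \<open>- Q / S\<close> is a Blaschke product
  of degree \<open>r - 1\<close>, and a prescribed eigenvalue with its multiplicity prescribes the jet of this
  Blaschke product at that point. So the claim is that \<open>r\<close> interpolation conditions in the disk
  determine a Blaschke product of degree \<open>r - 1\<close>.

  To see this, let \<open>V = Q S' - Q' S\<close> be formed from the two solutions. Away from the origin \<open>f\<close>
  and \<open>g\<close> have no common root (\<open>szego_no_common_root\<close>), so \<open>V\<close> vanishes at each prescribed
  eigenvalue to the prescribed order. Moreover \<open>S\<close> is a unimodular multiple of the reversal of
  \<open>Q\<close> (\<open>tail_reciprocal\<close>), whence \<open>V\<close> is proportional to its own reversal and its roots are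
  symmetric about the unit circle. This gives \<open>2 r\<close> roots, but the degree is at most
  \<open>2 r - 2\<close>; therefore \<open>V = 0\<close> (\<open>self_inversive_eq_0\<close>). Finally the Schur algorithm
  recovers the parameters from \<open>Q / S\<close> (\<open>tail_cross_eq_0_imp_eq\<close>).
\<close>

section \<open>The characteristic polynomial and the Szego recursion\<close>

lemma det_tridiagonal_Suc_Suc:
  fixes f :: "nat \<Rightarrow> nat \<Rightarrow> 'a :: comm_ring_1"
  assumes "\<And>i j. Suc j < i \<Longrightarrow> f i j = 0" "\<And>i j. Suc i < j \<Longrightarrow> f i j = 0"
  shows "det (mat (Suc (Suc n)) (Suc (Suc n)) (\<lambda>(i, j). f i j)) =
           f (Suc n) (Suc n) * det (mat (Suc n) (Suc n) (\<lambda>(i, j). f i j))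
         - f (Suc n) n * f n (Suc n) * det (mat n n (\<lambda>(i, j). f i j))"
proof -
  define A where "A = mat (Suc (Suc n)) (Suc (Suc n)) (\<lambda>(i, j). f i j)"
  define B where "B = mat_delete A (Suc n) n"
  have A: "A \<in> carrier_mat (Suc (Suc n)) (Suc (Suc n))" by (simp add: A_def)
  have B: "B \<in> carrier_mat (Suc n) (Suc n)" by (simp add: B_def A_def mat_delete_def)
  have BB: "B $$ (i, n) = f i (Suc n)" if "i \<le> n" for i
    using that by (simp add: B_def A_def mat_delete_def)
  have "det B = (\<Sum>i<Suc n. B $$ (i, n) * cofactor B i n)"
    by (rule laplace_expansion_column[OF B]) simp
  also have "\<dots> = B $$ (n, n) * cofactor B n n"
    by (simp add: BB assms)
  also have "cofactor B n n = det (mat n n (\<lambda>(i, j). f i j))"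
    unfolding cofactor_def
    by (simp, rule arg_cong[where f = det]) (auto simp: B_def A_def mat_delete_def)
  finally have detB: "det B = f n (Suc n) * det (mat n n (\<lambda>(i, j). f i j))"
    by (simp add: BB)
  have "det A = (\<Sum>j<Suc (Suc n). A $$ (Suc n, j) * cofactor A (Suc n) j)"
    by (rule laplace_expansion_row[OF A]) simp
  also have "\<dots> = A $$ (Suc n, n) * cofactor A (Suc n) n
               + A $$ (Suc n, Suc n) * cofactor A (Suc n) (Suc n)"
    by (simp add: A_def assms)
  also have "cofactor A (Suc n) (Suc n) = det (mat (Suc n) (Suc n) (\<lambda>(i, j). f i j))"
    unfolding cofactor_def
    by (simp, rule arg_cong[where f = det]) (auto simp: A_def mat_delete_def)
  also have "cofactor A (Suc n) n = - det B"
    unfolding cofactor_def B_def by simp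
  finally show ?thesis
    by (simp add: detB A_def[symmetric]) (simp add: A_def)
qed

text \<open>
  The Szego recursion for orthogonal polynomials on the unit circle, with transfer matrix
  \<open>((z, - cnj \<alpha>), (- \<alpha> z, 1))\<close>. The classical initial vector \<open>(1, 1)\<close> is replaced by
  \<open>(1, - a 0)\<close>, which accounts for the truncation: \<open>a 0\<close> stands where a unitary CMV matrix has
  the value \<open>-1\<close>.
\<close>
fun szego_phi szego_psi :: "(nat \<Rightarrow> complex) \<Rightarrow> nat \<Rightarrow> complex poly" where
  "szego_phi a 0 = 1"
| "szego_psi a 0 = [:- a 0:]"
| "szego_phi a (Suc n) = [:0, 1:] * szego_phi a n - [:cnj (a (Suc n)):] * szego_psi a n"
| "szego_psi a (Suc n) = szego_psi a n - [:0, a (Suc n):] * szego_phi a n"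

text \<open>
  With \<open>\<Theta> m = ((cnj (a m), \<rho> m), (\<rho> m, - a m))\<close> acting on the coordinates \<open>m\<close> and \<open>m + 1\<close>, a
  truncated CMV matrix is the product \<open>E O\<close> of the direct sums \<open>E\<close> of the blocks with even index
  and \<open>O\<close> of those with odd index, each cut down to the coordinates \<open>1, ..., N\<close>. The entries
  below are those of \<open>O\<close>.
\<close>
definition odd_factor :: "(nat \<Rightarrow> complex) \<Rightarrow> nat \<Rightarrow> nat \<Rightarrow> complex" where
  "odd_factor a i j =
     (if i = j then if odd i then cnj (a i) else - a (i - 1)
      else if (i = j + 1 \<or> j = i + 1) \<and> odd (min i j) then of_real (cmv_rho a (min i j))
      else 0)"

text \<open>
  The entries of \<open>x O\<inverse> - E\<close>. Since \<open>x - E O = (x O\<inverse> - E) O\<close>, this tridiagonal matrix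
  carries the characteristic polynomial of the pentadiagonal matrix \<open>E O\<close>. The block
  \<open>\<Theta> m\<close> is symmetric and unitary, so its inverse is its entrywise conjugate.
\<close>
definition cmv_pencil :: "(nat \<Rightarrow> complex) \<Rightarrow> complex \<Rightarrow> nat \<Rightarrow> nat \<Rightarrow> complex" where
  "cmv_pencil a x i j =
     (if i = j then if odd i then x * a i + a (i - 1) else - x * cnj (a (i - 1)) - cnj (a i)
      else if i = j + 1 \<or> j = i + 1
        then (if odd (min i j) then x else - 1) * of_real (cmv_rho a (min i j))
      else 0)"

lemma cmv_rho_mult:
  assumes "cmod (a n) \<le> 1"
  shows "complex_of_real (cmv_rho a n) * complex_of_real (cmv_rho a n) = 1 - a n * cnj (a n)"
proof -
  have "(cmod (a n))\<^sup>2 \<le> 1" using assms by (simp add: power_le_one)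
  hence "cmv_rho a n * cmv_rho a n = 1 - (cmod (a n))\<^sup>2"
    by (simp add: cmv_rho_def)
  thus ?thesis
    by (metis complex_norm_square of_real_1 of_real_diff of_real_mult)
qed

lemma det_odd_factor:
  assumes "\<And>i. i < n \<Longrightarrow> cmod (a i) \<le> 1"
  shows "det (mat n n (\<lambda>(i, j). odd_factor a (Suc i) (Suc j))) =
           (-1) ^ (n div 2) * (if odd n then cnj (a n) else 1)"
  using assms
proof (induction n rule: induct_nat_012)
  case 0
  then show ?case by simp
next
  case 1
  then show ?case by (simp add: det_single odd_factor_def)
next
  case (ge2 n)
  have rho: "complex_of_real (cmv_rho a (Suc n)) * complex_of_real (cmv_rho a (Suc n))
        = 1 - a (Suc n) * cnj (a (Suc n))"
    using ge2.prems by (intro cmv_rho_mult) auto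
  have rec: "det (mat (Suc (Suc n)) (Suc (Suc n)) (\<lambda>(i, j). odd_factor a (Suc i) (Suc j))) =
     odd_factor a (Suc (Suc n)) (Suc (Suc n))
       * det (mat (Suc n) (Suc n) (\<lambda>(i, j). odd_factor a (Suc i) (Suc j)))
     - odd_factor a (Suc (Suc n)) (Suc n) * odd_factor a (Suc n) (Suc (Suc n))
       * det (mat n n (\<lambda>(i, j). odd_factor a (Suc i) (Suc j)))"
    by (rule det_tridiagonal_Suc_Suc) (auto simp: odd_factor_def)
  have off: "odd_factor a (Suc (Suc n)) (Suc n) * odd_factor a (Suc n) (Suc (Suc n))
      = (if even n then 1 - a (Suc n) * cnj (a (Suc n)) else 0)"
    by (simp add: odd_factor_def rho)
  have ih: "det (mat n n (\<lambda>(i, j). odd_factor a (Suc i) (Suc j))) =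
           (-1) ^ (n div 2) * (if odd n then cnj (a n) else 1)"
    "det (mat (Suc n) (Suc n) (\<lambda>(i, j). odd_factor a (Suc i) (Suc j))) =
           (-1) ^ (Suc n div 2) * (if odd n then 1 else cnj (a (Suc n)))"
    using ge2 by auto
  show ?case
    unfolding rec off ih by (cases "odd n") (auto simp: odd_factor_def algebra_simps)
qed

text \<open>
  The leading minors alternate, up to sign, between the two components of the Szego recursion.
  The three-term recursion of the minors closes because one Szego step can be inverted: for
  example \<open>psi (n + 1) + \<alpha> (n + 1) phi (n + 1) = (1 - |\<alpha> (n + 1)|\<^sup>2) psi n\<close>.
\<close>
lemma det_cmv_pencil:
  assumes "\<And>i. i < n \<Longrightarrow> cmod (a i) \<le> 1"
  shows "det (mat n n (\<lambda>(i, j). cmv_pencil a x (Suc i) (Suc j))) =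
           (if odd n then (-1) ^ Suc (n div 2) * poly (szego_psi a n) x
            else (-1) ^ (n div 2) * poly (szego_phi a n) x)"
  using assms
proof (induction n rule: induct_nat_012)
  case 0
  then show ?case by simp
next
  case 1
  then show ?case by (simp add: det_single cmv_pencil_def)
next
  case (ge2 n)
  have rho: "complex_of_real (cmv_rho a (Suc n)) * complex_of_real (cmv_rho a (Suc n))
        = 1 - a (Suc n) * cnj (a (Suc n))"
    using ge2.prems by (intro cmv_rho_mult) auto
  have rec: "det (mat (Suc (Suc n)) (Suc (Suc n)) (\<lambda>(i, j). cmv_pencil a x (Suc i) (Suc j))) =
     cmv_pencil a x (Suc (Suc n)) (Suc (Suc n))
       * det (mat (Suc n) (Suc n) (\<lambda>(i, j). cmv_pencil a x (Suc i) (Suc j)))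
     - cmv_pencil a x (Suc (Suc n)) (Suc n) * cmv_pencil a x (Suc n) (Suc (Suc n))
       * det (mat n n (\<lambda>(i, j). cmv_pencil a x (Suc i) (Suc j)))"
    by (rule det_tridiagonal_Suc_Suc) (auto simp: cmv_pencil_def)
  have off: "cmv_pencil a x (Suc (Suc n)) (Suc n) * cmv_pencil a x (Suc n) (Suc (Suc n))
      = (if even n then x\<^sup>2 else 1) * (1 - a (Suc n) * cnj (a (Suc n)))"
    by (simp add: cmv_pencil_def rho[symmetric] power2_eq_square)
  have ih: "det (mat n n (\<lambda>(i, j). cmv_pencil a x (Suc i) (Suc j))) =
           (if odd n then (-1) ^ Suc (n div 2) * poly (szego_psi a n) x
            else (-1) ^ (n div 2) * poly (szego_phi a n) x)"
    "det (mat (Suc n) (Suc n) (\<lambda>(i, j). cmv_pencil a x (Suc i) (Suc j))) =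
           (if odd n then (-1) ^ (Suc n div 2) * poly (szego_phi a (Suc n)) x
            else (-1) ^ Suc (Suc n div 2) * poly (szego_psi a (Suc n)) x)"
    using ge2 by auto
  show ?case
    unfolding rec off ih
    by (cases "odd n") (auto simp: cmv_pencil_def algebra_simps power2_eq_square)
qed

lemma cmv_pencil_mult_odd_factor:
  assumes a: "cmv_params N a"
  shows "mat N N (\<lambda>(i, j). cmv_pencil a x (Suc i) (Suc j))
           * mat N N (\<lambda>(i, j). odd_factor a (Suc i) (Suc j))
         = x \<cdot>\<^sub>m 1\<^sub>m N - trunc_cmv N a" (is "?J * ?O = ?R")
proof (rule eq_matI)
  fix i j assume "i < dim_row ?R" "j < dim_col ?R"
  hence i: "i < N" and j: "j < N" by (auto simp: trunc_cmv_def)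
  have aj: "cmod (a k) \<le> 1" if "k \<le> N" for k
    using a that by (auto simp: cmv_params_def less_le)
  have rhoN: "cmv_rho a N = 0" using a by (simp add: cmv_params_def cmv_rho_def)
  have "(?J * ?O) $$ (i, j) =
      (\<Sum>k<N. cmv_pencil a x (Suc i) (Suc k) * odd_factor a (Suc k) (Suc j))"
    using i j by (simp add: scalar_prod_def atLeast0LessThan)
  also have "\<dots> = (\<Sum>k<Suc N. cmv_pencil a x (Suc i) (Suc k) * odd_factor a (Suc k) (Suc j))"
    \<comment> \<open>Since \<open>\<rho> N = 0\<close>, the last column need not be treated apart when \<open>N\<close> is odd.\<close>
    using j rhoN by (auto simp: odd_factor_def)
  also have "\<dots> = x * (if i = j then 1 else 0) - cmv_entry a (Suc i) (Suc j)"
  proof (cases "odd j")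
    case True
    hence "(\<Sum>k<Suc N. cmv_pencil a x (Suc i) (Suc k) * odd_factor a (Suc k) (Suc j))
      = (\<Sum>k\<in>{j - 1, j}. cmv_pencil a x (Suc i) (Suc k) * odd_factor a (Suc k) (Suc j))"
      using j by (intro sum.mono_neutral_right) (auto simp: odd_factor_def)
    also have "\<dots> = cmv_pencil a x (Suc i) j * of_real (cmv_rho a j)
        - cmv_pencil a x (Suc i) (Suc j) * a j"
      using True by (cases j) (auto simp: odd_factor_def)
    also have "\<dots> = x * (if i = j then 1 else 0) - cmv_entry a (Suc i) (Suc j)"
    proof -
      consider "i = j" | "i = Suc j" | "j = Suc i" | "j = Suc (Suc i)" | "i = Suc (Suc j)"
        | "i > Suc (Suc j) \<or> j > Suc (Suc i)" by linarith
      then show ?thesis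
      proof cases
        case 1
        hence "cmv_pencil a x (Suc i) j * of_real (cmv_rho a j)
             - cmv_pencil a x (Suc i) (Suc j) * a j
          = x * (of_real (cmv_rho a j) * of_real (cmv_rho a j) + a j * cnj (a j))
            - cmv_entry a (Suc i) (Suc j)"
          using True by (simp add: cmv_pencil_def cmv_entry_def algebra_simps)
        also have "\<dots> = x * (if i = j then 1 else 0) - cmv_entry a (Suc i) (Suc j)"
          using 1 j by (simp add: cmv_rho_mult aj)
        finally show ?thesis .
      qed (use True in \<open>auto simp: cmv_pencil_def cmv_entry_def algebra_simps\<close>)
    qed
    finally show ?thesis .
  next
    case False
    hence "(\<Sum>k<Suc N. cmv_pencil a x (Suc i) (Suc k) * odd_factor a (Suc k) (Suc j))
      = (\<Sum>k\<in>{j, Suc j}. cmv_pencil a x (Suc i) (Suc k) * odd_factor a (Suc k) (Suc j))"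
      using j by (intro sum.mono_neutral_right) (auto simp: odd_factor_def)
    also have "\<dots> = cmv_pencil a x (Suc i) (Suc j) * cnj (a (Suc j))
        + cmv_pencil a x (Suc i) (Suc (Suc j)) * of_real (cmv_rho a (Suc j))"
      using False by (auto simp: odd_factor_def)
    also have "\<dots> = x * (if i = j then 1 else 0) - cmv_entry a (Suc i) (Suc j)"
    proof -
      consider "i = j" | "i = Suc j" | "j = Suc i" | "j = Suc (Suc i)" | "i = Suc (Suc j)"
        | "i > Suc (Suc j) \<or> j > Suc (Suc i)" by linarith
      then show ?thesis
      proof cases
        case 1
        hence "cmv_pencil a x (Suc i) (Suc j) * cnj (a (Suc j))
             + cmv_pencil a x (Suc i) (Suc (Suc j)) * of_real (cmv_rho a (Suc j))
          = x * (of_real (cmv_rho a (Suc j)) * of_real (cmv_rho a (Suc j)) + a (Suc j) * cnj (a (Suc j)))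
            - cmv_entry a (Suc i) (Suc j)"
          using False by (simp add: cmv_pencil_def cmv_entry_def algebra_simps)
        also have "\<dots> = x * (if i = j then 1 else 0) - cmv_entry a (Suc i) (Suc j)"
          using 1 j by (simp add: cmv_rho_mult aj)
        finally show ?thesis .
      qed (use False in \<open>auto simp: cmv_pencil_def cmv_entry_def algebra_simps\<close>)
    qed
    finally show ?thesis .
  qed
  also have "\<dots> = ?R $$ (i, j)"
    using i j by (simp add: trunc_cmv_def)
  finally show "(?J * ?O) $$ (i, j) = ?R $$ (i, j)" .
qed (auto simp: trunc_cmv_def)

lemma char_poly_trunc_cmv:
  assumes a: "cmv_params N a"
  shows "char_poly (trunc_cmv N a) = szego_phi a N"
proof (cases N)
  case 0
  then show ?thesis by (simp add: char_poly_def trunc_cmv_def char_poly_matrix_def)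
next
  case (Suc n)
  have le: "cmod (a k) \<le> 1" if "k < N" for k
    using a that by (auto simp: cmv_params_def less_le)
  have T: "trunc_cmv N a \<in> carrier_mat N N" by (simp add: trunc_cmv_def)
  have "cnj (a N) * a N = 1"
    using a complex_norm_square[of "a N"] by (simp add: cmv_params_def mult.commute)
  \<comment> \<open>For odd \<open>N\<close> the pencil yields the second component; at the unimodular last parameter
    the two components are proportional.\<close>
  hence last: "- (cnj (a N) * poly (szego_psi a N) x) = poly (szego_phi a N) x" for x
    by (simp add: Suc algebra_simps flip: mult.assoc)
  have "poly (char_poly (trunc_cmv N a)) x = poly (szego_phi a N) x" for x
  proof -
    let ?J = "mat N N (\<lambda>(i, j). cmv_pencil a x (Suc i) (Suc j))"
    let ?O = "mat N N (\<lambda>(i, j). odd_factor a (Suc i) (Suc j))"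
    have "poly (char_poly (trunc_cmv N a)) x = det (- (char_matrix (trunc_cmv N a) x))"
      by (rule char_poly_matrix[OF T])
    also have "- (char_matrix (trunc_cmv N a) x) = x \<cdot>\<^sub>m 1\<^sub>m N - trunc_cmv N a"
      by (rule eq_matI) (auto simp: char_matrix_def trunc_cmv_def)
    also have "\<dots> = ?J * ?O"
      by (rule cmv_pencil_mult_odd_factor[OF a, symmetric])
    also have "det \<dots> = det ?J * det ?O"
      by (rule det_mult[of _ N]) auto
    also have "\<dots> = poly (szego_phi a N) x"
      using le last[of x]
      by (simp add: det_odd_factor det_cmv_pencil algebra_simps flip: power_add mult_2)
    finally show ?thesis .
  qed
  hence "poly (char_poly (trunc_cmv N a)) = poly (szego_phi a N)" by (rule ext)
  thus ?thesis by (simp add: poly_eq_poly_eq_iff)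
qed

section \<open>Self-inversive polynomials\<close>

lemma poly_eq_if_eq_off_zero:
  fixes p q :: "'a :: field_char_0 poly"
  assumes "\<And>x. x \<noteq> 0 \<Longrightarrow> poly p x = poly q x"
  shows "p = q"
proof (rule ccontr)
  assume "p \<noteq> q"
  hence "finite {x. poly (p - q) x = 0}" by (intro poly_roots_finite) auto
  moreover have "UNIV - {0} \<subseteq> {x. poly (p - q) x = 0}" using assms by auto
  ultimately have "finite (UNIV - {0 :: 'a})" by (rule finite_subset[rotated])
  thus False by (simp add: infinite_UNIV_char_0)
qed

text \<open>
  The reversed polynomial \<open>z\<^sup>n cnj (p (1 / cnj z))\<close>. The length \<open>n\<close> is given separately
  because the polynomials it is applied to may have smaller degree.
\<close>
definition conj_reverse :: "nat \<Rightarrow> complex poly \<Rightarrow> complex poly" where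
  "conj_reverse n p = (\<Sum>i\<le>n. monom (cnj (coeff p (n - i))) i)"

lemma poly_conj_reverse:
  assumes "degree p \<le> n" "x \<noteq> 0"
  shows "poly (conj_reverse n p) x = x ^ n * cnj (poly p (inverse (cnj x)))"
proof -
  have "poly p y = (\<Sum>i\<le>n. coeff p i * y ^ i)" for y
    unfolding poly_altdef using assms(1)
    by (intro sum.mono_neutral_left) (auto simp: coeff_eq_0)
  hence "x ^ n * cnj (poly p (inverse (cnj x))) = (\<Sum>i\<le>n. cnj (coeff p i) * (x ^ n * inverse x ^ i))"
    by (simp add: sum_distrib_left mult_ac)
  also have "\<dots> = (\<Sum>i\<le>n. cnj (coeff p i) * x ^ (n - i))"
    using assms(2) by (intro sum.cong) (auto simp: power_diff power_inverse field_simps)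
  also have "\<dots> = (\<Sum>i\<le>n. cnj (coeff p (n - i)) * x ^ i)"
    by (rule sum.reindex_bij_witness[of _ "\<lambda>i. n - i" "\<lambda>i. n - i"]) auto
  also have "\<dots> = poly (conj_reverse n p) x"
    by (simp add: conj_reverse_def poly_sum poly_monom)
  finally show ?thesis ..
qed

text \<open>
  Reversal turns the factor \<open>z - w\<close> into \<open>1 - cnj w z\<close>, whose root is the mirror image of \<open>w\<close> in
  the unit circle; a polynomial proportional to its own reversal contains both factors to the
  same power.
\<close>
lemma self_inversive_reflected_root:
  assumes deg: "degree p \<le> n" and "p \<noteq> 0"
    and inv: "\<And>x. x \<noteq> 0 \<Longrightarrow> poly p x = \<kappa> * x ^ n * cnj (poly p (inverse (cnj x)))"
    and "w \<noteq> 0" and dvd: "[:-w, 1:] ^ l dvd p"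
  shows "[:- inverse (cnj w), 1:] ^ l dvd p"
proof -
  from dvd obtain q where q: "p = [:-w, 1:] ^ l * q" by blast
  with \<open>p \<noteq> 0\<close> have "q \<noteq> 0" by auto
  have "degree p = l + degree q"
    using \<open>q \<noteq> 0\<close> by (simp add: q degree_mult_eq degree_power_eq)
  hence l: "l \<le> n" and degq: "degree q \<le> n - l" using deg by auto
  define t where "t = Polynomial.smult \<kappa> (conj_reverse (n - l) q)"
  have "p = [:1, - cnj w:] ^ l * t"
  proof (rule poly_eq_if_eq_off_zero)
    fix x :: complex assume x: "x \<noteq> 0"
    have "poly p x = \<kappa> * x ^ n * ((inverse x - cnj w) ^ l * cnj (poly q (inverse (cnj x))))"
      by (subst inv[OF x]) (simp add: q poly_power)
    also have "x ^ n = x ^ l * x ^ (n - l)" using l by (simp flip: power_add)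
    also have "\<kappa> * (x ^ l * x ^ (n - l)) * ((inverse x - cnj w) ^ l * cnj (poly q (inverse (cnj x))))
      = (x * (inverse x - cnj w)) ^ l * (\<kappa> * (x ^ (n - l) * cnj (poly q (inverse (cnj x)))))"
      by (simp add: power_mult_distrib)
    also have "x * (inverse x - cnj w) = 1 - cnj w * x" using x by (simp add: field_simps)
    finally show "poly p x = poly ([:1, - cnj w:] ^ l * t) x"
      using x degq by (simp add: t_def poly_power poly_conj_reverse mult.commute)
  qed
  moreover have "[:1, - cnj w:] = Polynomial.smult (- cnj w) [:- inverse (cnj w), 1:]"
    using \<open>w \<noteq> 0\<close> by simp
  ultimately have "p = Polynomial.smult ((- cnj w) ^ l) ([:- inverse (cnj w), 1:] ^ l * t)"
    by (metis mult_smult_left smult_power)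
  thus ?thesis by (metis dvd_smult dvd_triv_left)
qed

lemma sum_order_le_degree:
  fixes p :: "'a :: idom poly"
  assumes "p \<noteq> 0" "finite A"
  shows "(\<Sum>x\<in>A. order x p) \<le> degree p"
proof -
  have "(\<Sum>x\<in>A. order x p) = (\<Sum>x\<in>A \<inter> {x. poly p x = 0}. order x p)"
    using assms by (intro sum.mono_neutral_right) (auto simp: order_root)
  also have "\<dots> \<le> (\<Sum>x\<in>{x. poly p x = 0}. order x p)"
    using assms by (intro sum_mono2) (auto simp: poly_roots_finite)
  also have "\<dots> = size (proots p)"
    using assms by (simp add: size_multiset_overloaded_eq)
  also have "\<dots> \<le> degree p" by (rule size_proots_le)
  finally show ?thesis .
qed

text \<open>
  Roots in the punctured open disk have distinct mirror images outside it, so they count twice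
  against the degree.
\<close>
lemma self_inversive_eq_0:
  assumes deg: "degree p \<le> n"
    and inv: "\<And>x. x \<noteq> 0 \<Longrightarrow> poly p x = \<kappa> * x ^ n * cnj (poly p (inverse (cnj x)))"
    and I: "finite I" "inj_on z I"
    and z: "\<And>i. i \<in> I \<Longrightarrow> z i \<noteq> 0 \<and> cmod (z i) < 1"
    and dvd: "\<And>i. i \<in> I \<Longrightarrow> [:- z i, 1:] ^ l i dvd p"
    and n: "n < 2 * (\<Sum>i\<in>I. l i)"
  shows "p = 0"
proof (rule ccontr)
  assume p: "p \<noteq> 0"
  define z' where "z' i = inverse (cnj (z i))" for i
  have inj': "inj_on z' I"
    using I(2) by (auto simp: inj_on_def z'_def)
  have disj: "z ` I \<inter> z' ` I = {}"
  proof -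
    have "cmod (z i) < 1" "1 < cmod (z' i)" if "i \<in> I" for i
      using z[OF that] by (auto simp: z'_def norm_inverse one_less_inverse_iff)
    thus ?thesis by fastforce
  qed
  have "l i \<le> order (z i) p" if "i \<in> I" for i
    using dvd[OF that] p by (simp add: order_divides)
  moreover have "l i \<le> order (z' i) p" if "i \<in> I" for i
    using self_inversive_reflected_root[OF deg p inv _ dvd[OF that]] z[OF that] p
    by (simp add: order_divides z'_def)
  ultimately have "2 * (\<Sum>i\<in>I. l i) \<le> (\<Sum>i\<in>I. order (z i) p) + (\<Sum>i\<in>I. order (z' i) p)"
    unfolding mult_2 by (intro add_mono sum_mono) auto
  also have "\<dots> = (\<Sum>x\<in>z ` I \<union> z' ` I. order x p)"
    using I inj' disj by (simp add: sum.union_disjoint sum.reindex)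
  also have "\<dots> \<le> degree p"
    using I p by (intro sum_order_le_degree) auto
  finally show False using deg n by simp
qed

lemma linear_power_dvd_mult_cancel:
  fixes p q :: "'a :: idom poly"
  assumes "[:-w, 1:] ^ l dvd p * q" "poly p w \<noteq> 0"
  shows "[:-w, 1:] ^ l dvd q"
proof (cases "q = 0")
  case False
  moreover from assms(2) have "p \<noteq> 0" by auto
  ultimately show ?thesis
    using assms by (simp add: order_divides order_mult order_0I)
qed simp

section \<open>Splitting the Szego recursion\<close>

lemma mult_cnj_neq_1:
  assumes "cmod w < 1"
  shows "w * cnj w \<noteq> 1"
proof
  assume "w * cnj w = 1"
  hence "(cmod w)\<^sup>2 = 1" by (metis complex_mod_mult_cnj norm_one)
  thus False using assms norm_ge_zero[of w] by (auto simp: power2_eq_1_iff)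
qed

text \<open>
  The transfer matrix has determinant \<open>z (1 - |\<alpha>|\<^sup>2)\<close>, so away from the origin it sends no
  nonzero vector to zero.
\<close>
lemma szego_no_common_root:
  assumes "x \<noteq> 0" "\<And>j. 1 \<le> j \<Longrightarrow> j \<le> n \<Longrightarrow> cmod (a j) < 1"
  shows "poly (szego_phi a n) x \<noteq> 0 \<or> poly (szego_psi a n) x \<noteq> 0"
  using assms(2)
proof (induction n)
  case 0
  then show ?case by simp
next
  case (Suc n)
  show ?case
  proof (rule ccontr)
    let ?f = "poly (szego_phi a n) x" and ?g = "poly (szego_psi a n) x" and ?\<alpha> = "a (Suc n)"
    assume "\<not> ?thesis"
    hence f: "x * ?f = cnj ?\<alpha> * ?g" and g: "?g = ?\<alpha> * (x * ?f)" by auto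
    have "?\<alpha> * cnj ?\<alpha> \<noteq> 1" using Suc.prems by (intro mult_cnj_neq_1) simp
    moreover have "?g = ?\<alpha> * (cnj ?\<alpha> * ?g)" using g unfolding f .
    hence "(1 - ?\<alpha> * cnj ?\<alpha>) * ?g = 0" by (simp add: algebra_simps)
    ultimately have "?g = 0" by simp
    with f assms(1) have "?f = 0" by simp
    with \<open>?g = 0\<close> Suc show False by simp
  qed
qed

lemma szego_cong:
  assumes "\<And>j. j \<le> n \<Longrightarrow> a j = b j"
  shows "szego_phi a n = szego_phi b n \<and> szego_psi a n = szego_psi b n"
  using assms by (induction n) auto

text \<open>
  The row vector \<open>(z tail_q, tail_s)\<close> is the product of the top row \<open>(z, - cnj (a N))\<close> of the last
  transfer matrix with the \<open>d\<close> transfer matrices before it, those of \<open>a (N - 1), ..., a (N - d)\<close>.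
  Its first entry is always divisible by \<open>z\<close>; dropping that factor lowers the degree to \<open>d\<close>,
  and the degree count at the end needs exactly this. For the parameters of a truncated
  CMV matrix, \<open>- tail_q / tail_s\<close> is the Blaschke product of degree \<open>d\<close> with Schur parameters
  \<open>a (N - d), ..., a N\<close>.
\<close>
fun tail_q tail_s :: "(nat \<Rightarrow> complex) \<Rightarrow> nat \<Rightarrow> nat \<Rightarrow> complex poly" where
  "tail_q a N 0 = 1"
| "tail_s a N 0 = [:- cnj (a N):]"
| "tail_q a N (Suc d) = [:0, 1:] * tail_q a N d - [:a (N - Suc d):] * tail_s a N d"
| "tail_s a N (Suc d) = tail_s a N d - [:0, cnj (a (N - Suc d)):] * tail_q a N d"

lemma szego_phi_split:
  assumes "d < N"
  shows "szego_phi a N = [:0, 1:] * tail_q a N d * szego_phi a (N - Suc d)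
                        + tail_s a N d * szego_psi a (N - Suc d)"
  using assms
proof (induction d)
  case 0
  then show ?case by (cases N) auto
next
  case (Suc d)
  define k where "k = N - Suc (Suc d)"
  have k: "N - Suc d = Suc k" "N - Suc (Suc d) = k" using Suc.prems by (auto simp: k_def)
  have X: "[:0, c:] = [:c:] * [:0, 1:]" for c :: complex by simp
  have regroup: "x * q * (x * f - c * g) + s * (g - e * x * f)
                 = x * (x * q - e * s) * f + (s - c * x * q) * g"
    for x q s f g c e :: "complex poly"
    by (simp add: algebra_simps)
  have "szego_phi a N = [:0, 1:] * tail_q a N d * szego_phi a (Suc k)
                        + tail_s a N d * szego_psi a (Suc k)"
    using Suc.IH Suc.prems k by simp
  thus ?case
    unfolding k tail_q.simps tail_s.simps szego_phi.simps szego_psi.simps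
      X[of "a (Suc k)"] X[of "cnj (a (Suc k))"] regroup .
qed

lemma degree_tail:
  "degree (tail_q a N d) \<le> d" "degree (tail_s a N d) \<le> d"
proof (induction d)
  case (Suc d)
  { case 1
    have "degree ([:0, 1:] * tail_q a N d) \<le> Suc d"
      using degree_mult_le[of "[:0, 1:]" "tail_q a N d"] Suc by simp
    moreover have "degree ([:a (N - Suc d):] * tail_s a N d) \<le> Suc d"
      using degree_mult_le[of "[:a (N - Suc d):]" "tail_s a N d"] Suc by simp
    ultimately show ?case by (simp only: tail_q.simps degree_diff_le)
  next
    case 2
    have "degree [:0, cnj (a (N - Suc d)):] \<le> 1" by simp
    hence "degree ([:0, cnj (a (N - Suc d)):] * tail_q a N d) \<le> Suc d"
      using degree_mult_le[of "[:0, cnj (a (N - Suc d)):]" "tail_q a N d"] Suc(1) by linarith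
    thus ?case using Suc by (simp only: tail_s.simps degree_diff_le le_SucI) }
qed auto

lemma poly_tail_s_0: "poly (tail_s a N d) 0 = - cnj (a N)"
  by (induction d) auto

text \<open>
  Each transfer step preserves the relation that the two components are reversals of each other
  up to the unimodular constant \<open>- cnj (a N)\<close>, which is the case for the starting row. The
  second identity is the first one read at \<open>1 / cnj x\<close>.
\<close>
lemma tail_reciprocal:
  assumes "cmod (a N) = 1" "x \<noteq> 0"
  shows "poly (tail_s a N d) x
           = - cnj (a N) * x ^ d * cnj (poly (tail_q a N d) (inverse (cnj x)))"
    and "poly (tail_q a N d) x
           = - cnj (a N) * x ^ d * cnj (poly (tail_s a N d) (inverse (cnj x)))"
proof -
  have unit: "cnj (a N) * a N = 1"
    using assms(1) complex_norm_square[of "a N"] by (simp add: mult.commute)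
  \<comment> \<open>The map \<open>q \<mapsto> - cnj (a N) * y ^ n * cnj q\<close> undoes its counterpart at the mirror image
    of \<open>y\<close>.\<close>
  have swap: "q = - cnj (a N) * y ^ n * cnj (- cnj (a N) * inverse (cnj y) ^ n * cnj q)"
    if "y \<noteq> 0" for q y n
  proof -
    have "- cnj (a N) * y ^ n * cnj (- cnj (a N) * inverse (cnj y) ^ n * cnj q)
        = (cnj (a N) * a N) * (y ^ n * inverse y ^ n) * q" by simp
    also have "\<dots> = q" using unit that by (simp flip: power_mult_distrib)
    finally show ?thesis ..
  qed
  have main: "poly (tail_s a N d) x
           = - cnj (a N) * x ^ d * cnj (poly (tail_q a N d) (inverse (cnj x)))" if "x \<noteq> 0" for x
    using that
  proof (induction d arbitrary: x)
    case 0
    then show ?case by simp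
  next
    case (Suc d)
    let ?w = "inverse (cnj x)"
    let ?\<alpha> = "a (N - Suc d)"
    have w: "poly (tail_s a N d) ?w = - cnj (a N) * ?w ^ d * cnj (poly (tail_q a N d) x)"
      using Suc.IH[of ?w] Suc.prems by simp
    have "- cnj (a N) * x ^ Suc d * cnj (poly (tail_q a N (Suc d)) ?w)
       = - cnj (a N) * x ^ d * cnj (poly (tail_q a N d) ?w) * (x * inverse x)
         - cnj ?\<alpha> * x * (- cnj (a N) * x ^ d * cnj (poly (tail_s a N d) ?w))"
      by (simp add: algebra_simps)
    also have "- cnj (a N) * x ^ d * cnj (poly (tail_s a N d) ?w) = poly (tail_q a N d) x"
      unfolding w using swap[OF Suc.prems] by metis
    also have "- cnj (a N) * x ^ d * cnj (poly (tail_q a N d) ?w) = poly (tail_s a N d) x"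
      using Suc.IH[OF Suc.prems] ..
    finally show ?case using Suc.prems by (simp add: algebra_simps)
  qed
  show "poly (tail_s a N d) x
           = - cnj (a N) * x ^ d * cnj (poly (tail_q a N d) (inverse (cnj x)))"
    by (rule main[OF assms(2)])
  have "poly (tail_s a N d) (inverse (cnj x))
      = - cnj (a N) * inverse (cnj x) ^ d * cnj (poly (tail_q a N d) x)"
    using main[of "inverse (cnj x)"] assms(2) by simp
  thus "poly (tail_q a N d) x
           = - cnj (a N) * x ^ d * cnj (poly (tail_s a N d) (inverse (cnj x)))"
    using swap[OF assms(2)] by metis
qed

text \<open>
  Up to sign, the numerator of the difference of the two Blaschke products that belong to \<open>a\<close> and \<open>b\<close>.
\<close>
definition tail_cross :: "(nat \<Rightarrow> complex) \<Rightarrow> (nat \<Rightarrow> complex) \<Rightarrow> nat \<Rightarrow> nat \<Rightarrow> complex poly" where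
  "tail_cross a b N d = tail_q a N d * tail_s b N d - tail_q b N d * tail_s a N d"

lemma degree_tail_cross: "degree (tail_cross a b N d) \<le> 2 * d"
proof -
  have "degree (tail_q u N d * tail_s v N d) \<le> 2 * d" for u v
    using degree_mult_le[of "tail_q u N d" "tail_s v N d"] degree_tail[of u N d] degree_tail[of v N d]
    by linarith
  thus ?thesis unfolding tail_cross_def by (intro degree_diff_le)
qed

text \<open>
  Reversal exchanges \<open>tail_q\<close> and \<open>tail_s\<close>, hence maps the cross product to a multiple of itself.
\<close>
lemma tail_cross_self_inversive:
  assumes "cmod (a N) = 1" "cmod (b N) = 1" "x \<noteq> 0"
  shows "poly (tail_cross a b N d) x
           = - (cnj (a N) * cnj (b N)) * x ^ (2 * d)
             * cnj (poly (tail_cross a b N d) (inverse (cnj x)))"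
  unfolding tail_cross_def poly_diff poly_mult
    tail_reciprocal[where a = a and x = x, OF assms(1,3)]
    tail_reciprocal[where a = b and x = x, OF assms(2,3)]
  by (simp add: algebra_simps power_add mult_2 mult_2_right)

text \<open>
  A common transfer matrix on the right multiplies the cross product by its determinant, up to
  the factor \<open>z\<close> that was taken out of the first component.
\<close>
lemma tail_cross_Suc:
  assumes "a (N - Suc d) = b (N - Suc d)"
  shows "tail_cross a b N (Suc d)
         = [:0, 1 - b (N - Suc d) * cnj (b (N - Suc d)):] * tail_cross a b N d"
  by (rule poly_eq_if_eq_off_zero) (simp add: tail_cross_def assms algebra_simps)

text \<open>
  The Schur algorithm: \<open>- tail_q / tail_s\<close> takes the value \<open>a (N - d)\<close> at the origin, so equal
  quotients have equal first parameters, and then the quotients that remain after removing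
  these parameters are equal as well.
\<close>
lemma tail_cross_eq_0_imp_eq:
  assumes "tail_cross a b N d = 0"
    and "cmod (a N) = 1" "cmod (b N) = 1"
    and "\<And>j. j < N \<Longrightarrow> cmod (b j) < 1"
    and "d \<le> N" "N - d \<le> j" "j \<le> N"
  shows "a j = b j"
  using assms(1,5,6)
proof (induction d)
  case 0
  hence "j = N" using assms(7) by simp
  moreover from 0 have "[:cnj (a N) - cnj (b N):] = 0" by (simp add: tail_cross_def)
  ultimately show ?case by simp
next
  case (Suc d)
  let ?k = "N - Suc d"
  have nz: "a N \<noteq> 0" "b N \<noteq> 0" using assms(2,3) by auto
  have "poly (tail_cross a b N (Suc d)) 0 = 0" using Suc.prems by simp
  hence "(a ?k - b ?k) * (cnj (a N) * cnj (b N)) = 0"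
    by (auto simp: tail_cross_def poly_tail_s_0 algebra_simps)
  hence k: "a ?k = b ?k" using nz by simp
  have "b ?k * cnj (b ?k) \<noteq> 1" using Suc.prems by (intro mult_cnj_neq_1 assms(4)) simp
  hence "tail_cross a b N d = 0" using Suc.prems(1) tail_cross_Suc[of a N d b, OF k] by simp
  thus ?case using Suc k by (cases "j = ?k") auto
qed

lemma trunc_cmv_cong:
  assumes "\<And>j. j \<le> N \<Longrightarrow> a j = b j"
  shows "trunc_cmv N a = trunc_cmv N b"
  unfolding trunc_cmv_def
  by (rule eq_matI) (use assms in \<open>auto simp: cmv_entry_def cmv_rho_def\<close>)

section \<open>Uniqueness\<close>

theorem theorem7p4:
  fixes N m r :: nat and z :: "nat \<Rightarrow> complex" and l :: "nat \<Rightarrow> nat"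
    and \<alpha> :: "nat \<Rightarrow> complex" and P :: "complex mat \<Rightarrow> bool"
  defines "P \<equiv> \<lambda>T. (\<forall>i\<in>{1..m}. eigenvalue_of_mult T (z i) (l i)) \<and>
                   (\<exists>a. has_cmv_params N T a \<and> (\<forall>j\<le>N - r. a j = \<alpha> j))"
  assumes "m \<ge> 1"
    and "inj_on z {1..m}"
    and "\<And>i. i \<in> {1..m} \<Longrightarrow> z i \<noteq> 0 \<and> cmod (z i) < 1"
    and "\<And>i. i \<in> {1..m} \<Longrightarrow> l i > 0"
    and "r = (\<Sum>i=1..m. l i)" and "r \<le> N"
    and "\<And>j. j \<le> N - r \<Longrightarrow> cmod (\<alpha> j) < 1"
    and "\<exists>T. P T"
  shows "\<exists>!T. P T"
proof (rule ex_ex1I)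
  show "\<exists>T. P T" by fact
next
  fix T T' assume "P T" "P T'"
  then obtain a b where a: "cmv_params N a" "T = trunc_cmv N a" "\<And>j. j \<le> N - r \<Longrightarrow> a j = \<alpha> j"
    and b: "cmv_params N b" "T' = trunc_cmv N b" "\<And>j. j \<le> N - r \<Longrightarrow> b j = \<alpha> j"
    unfolding P_def has_cmv_params_def by blast
  \<comment> \<open>The parameters that are not prescribed are the last \<open>r = d + 1\<close>.\<close>
  have "l 1 \<le> r" unfolding assms(6) using \<open>m \<ge> 1\<close> by (intro member_le_sum) auto
  moreover have "l 1 > 0" using assms(5)[of 1] \<open>m \<ge> 1\<close> by simp
  ultimately obtain d where d: "r = Suc d" by (cases r) auto
  define f where "f = szego_phi a (N - r)"
  define g where "g = szego_psi a (N - r)"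
  have fg: "szego_phi b (N - r) = f" "szego_psi b (N - r) = g"
    using szego_cong[of "N - r" a b] a(3) b(3) by (auto simp: f_def g_def)
  have dN: "d < N" using d \<open>r \<le> N\<close> by simp
  have split_a: "szego_phi a N = [:0, 1:] * tail_q a N d * f + tail_s a N d * g"
    using szego_phi_split[OF dN, of a] d by (simp add: f_def g_def)
  have split_b: "szego_phi b N = [:0, 1:] * tail_q b N d * f + tail_s b N d * g"
    using szego_phi_split[OF dN, of b, folded d] by (simp only: fg)
  define V where "V = tail_cross a b N d"
  have V_dvd: "[:- z i, 1:] ^ l i dvd V" if i: "i \<in> {1..m}" for i
  proof -
    let ?u = "[:- z i, 1:] ^ l i"
    have dvd: "?u dvd szego_phi a N" "?u dvd szego_phi b N"
      using \<open>P T\<close> \<open>P T'\<close> i a b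
      by (auto simp: P_def eigenvalue_of_mult_def char_poly_trunc_cmv order_divides)
    \<comment> \<open>Both characteristic polynomials are combinations of the same \<open>f\<close> and \<open>g\<close>; by Cramer's
      rule a common divisor of the two divides \<open>z f V\<close> and \<open>g V\<close>.\<close>
    have cramer: "x * f * (q * s' - q' * s) = (x * q * f + s * g) * s' - (x * q' * f + s' * g) * s"
      "g * (q * s' - q' * s) = (x * q' * f + s' * g) * q - (x * q * f + s * g) * q'"
      for x q q' s s' :: "complex poly"
      by (simp_all add: algebra_simps)
    have f: "?u dvd ([:0, 1:] * f) * V"
      unfolding V_def tail_cross_def cramer(1) split_a[symmetric] split_b[symmetric]
      using dvd by (intro dvd_diff dvd_mult2)
    have g: "?u dvd g * V"
      unfolding V_def tail_cross_def cramer(2)[where x = "[:0, 1:]"]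
        split_a[symmetric] split_b[symmetric]
      using dvd by (intro dvd_diff dvd_mult2)
    have zi: "z i \<noteq> 0" using assms(4)[OF i] by simp
    have "cmod (a j) < 1" if "j \<le> N - r" for j
      using that a(3) assms(8) by simp
    hence "poly f (z i) \<noteq> 0 \<or> poly g (z i) \<noteq> 0"
      unfolding f_def g_def by (intro szego_no_common_root zi) auto
    thus ?thesis
    proof
      assume "poly f (z i) \<noteq> 0"
      thus ?thesis using zi by (intro linear_power_dvd_mult_cancel[OF f]) simp
    next
      assume "poly g (z i) \<noteq> 0"
      thus ?thesis by (rule linear_power_dvd_mult_cancel[OF g])
    qed
  qed
  have units: "cmod (a N) = 1" "cmod (b N) = 1" using a(1) b(1) by (auto simp: cmv_params_def)
  have "V = 0"
    unfolding V_def
  proof (rule self_inversive_eq_0[OF degree_tail_cross tail_cross_self_inversive[of a N b, OF units]])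
    \<comment> \<open>\<open>V\<close> has degree at most \<open>2 * r - 2\<close>, and \<open>2 * r\<close> roots are forced.\<close>
    show "2 * d < 2 * (\<Sum>i\<in>{1..m}. l i)" using d assms(6) by simp
  qed (use V_dvd assms(3,4) in \<open>auto simp: V_def\<close>)
  have "a j = b j" if "j \<le> N" for j
  proof (cases "j \<le> N - r")
    case True
    then show ?thesis using a(3) b(3) by simp
  next
    case False
    then show ?thesis
      using \<open>V = 0\<close> units b(1) dN d that unfolding V_def
      by (intro tail_cross_eq_0_imp_eq[of a b N d]) (auto simp: cmv_params_def)
  qed
  thus "T = T'" unfolding a(2) b(2) by (rule trunc_cmv_cong)
qed

end
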